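(* Let $\rho\in\{\rho_{RU},\rho_{RD},\rho_{RZ},\rho_{RN}\}$ be a rounding function with unit roundoff $u$, where $0<u<1$. For every real number $x\in\mathbb{R}$ (assuming no underflow or overflow occurs) there exists $\delta\in\mathbb{R}$ such that $$\rho(x)=x e^{\delta},\qquad |\delta|\le \frac{u}{1-u}.$$
   Context: Fix a precision $p$ (a positive integer). The assumption that no underflow or overflow occurs is modelled by taking the binary floating-point numbers of precision $p$ with unbounded exponent range: $\mathbb{F}=\{m\cdot 2^{e} : m,e\in\mathbb{Z},\ |m|<2^{p}\}\subset\mathbb{R}$ (no NaN or infinities). The rounding functions $\rho:\mathbb{R}\to\mathbb{F}$ are: $\rho_{RU}(a)=\min\{b\in\mathbb{F}: b\ge a\}$ (towards $+\infty$); $\rho_{RD}(a)=\max\{b\in\mathbb{F}: b\le a\}$ (towards $-\infty$); $\rho_{RZ}(a)=\rho_{RU}(a)$ if $a<0$ and $\rho_{RD}(a)$ otherwise (towards zero); $\rho_{RN}(a)$ is an element $b\in\mathbb{F}$ with $|a-b|\le|a-c|$ for all $c\in\mathbb{F}$ (to nearest, with arbitrary tie breaking). The unit roundoff is $u=2^{1-p}$ for $\rho_{RU},\rho_{RD},\rho_{RZ}$ and $u=2^{-p}$ for $\rho_{RN}$. *)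

theory Defs
  imports Complex_Main
begin

definition floats :: "nat \<Rightarrow> real set" where
  "floats p = {of_int m * 2 powi e | m e :: int. \<bar>m\<bar> < 2 ^ p}"

text \<open>Minimum and maximum over the infinite set of floating-point numbers are
  \<open>LEAST\<close> and \<open>GREATEST\<close>; for \<open>p > 0\<close> both are attained, because the
  floating-point numbers accumulate only at \<open>0\<close>, which is itself one.\<close>

definition round_RU :: "nat \<Rightarrow> real \<Rightarrow> real" where
  "round_RU p a = (LEAST b. b \<in> floats p \<and> b \<ge> a)"

definition round_RD :: "nat \<Rightarrow> real \<Rightarrow> real" where
  "round_RD p a = (GREATEST b. b \<in> floats p \<and> b \<le> a)"

definition round_RZ :: "nat \<Rightarrow> real \<Rightarrow> real" where
  "round_RZ p a = (if a < 0 then round_RU p a else round_RD p a)"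

text \<open>Rounding to nearest is a predicate on functions, so that ties may be broken
  arbitrarily, independently at each argument.\<close>

definition is_round_RN :: "nat \<Rightarrow> (real \<Rightarrow> real) \<Rightarrow> bool" where
  "is_round_RN p \<rho> \<longleftrightarrow>
     (\<forall>a. \<rho> a \<in> floats p \<and> (\<forall>c \<in> floats p. \<bar>a - \<rho> a\<bar> \<le> \<bar>a - c\<bar>))"

definition rounding :: "nat \<Rightarrow> (real \<Rightarrow> real) \<Rightarrow> real \<Rightarrow> bool" where
  "rounding p \<rho> u \<longleftrightarrow>
     \<rho> \<in> {round_RU p, round_RD p, round_RZ p} \<and> u = 2 powi (1 - int p) \<or>
     is_round_RN p \<rho> \<and> u = 2 powi (- int p)"

end

theory Submission
  imports Defs
begin

text \<open>
  Every real \<open>x\<close> has a greatest floating-point number \<open>lo\<close> below it and a least one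
  \<open>hi\<close> above it (each possibly equal to \<open>x\<close>), and they satisfy \<open>hi - lo \<le> 2\<^sup>1\<^sup>-\<^sup>p \<bar>x\<bar>\<close>
  (\<open>floats_bracket\<close>). Indeed, if \<open>2\<^sup>e \<le> \<bar>x\<bar> < 2\<^sup>e\<^sup>+\<^sup>1\<close>, then the floating-point
  numbers with magnitude between \<open>2\<^sup>e\<close> and \<open>2\<^sup>e\<^sup>+\<^sup>1\<close>, both included, are exactly the
  multiples of \<open>2\<^sup>e\<^sup>+\<^sup>1\<^sup>-\<^sup>p\<close> in that range, and this step is at most \<open>2\<^sup>1\<^sup>-\<^sup>p \<bar>x\<bar>\<close>.
  Directed rounding returns \<open>lo\<close> or \<open>hi\<close>, and rounding to nearest is at most half the gap
  away from \<open>x\<close>, so in each case \<open>\<bar>\<rho> x - x\<bar> \<le> u \<bar>x\<bar>\<close>.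

  It remains to turn the relative error \<open>\<rho> x = x (1 + \<epsilon>)\<close> with \<open>\<bar>\<epsilon>\<bar> \<le> u < 1\<close> into an
  exponential one: take \<open>\<delta> = ln (1 + \<epsilon>)\<close>. The upper estimate \<open>\<delta> \<le> \<epsilon>\<close> gives even \<open>\<delta> \<le> u\<close>; the
  lower one, \<open>\<delta> \<ge> \<epsilon> / (1 + \<epsilon>)\<close>, is where the denominator \<open>1 - u\<close> comes from.
\<close>

text \<open>The significand \<open>\<plusminus>2\<^sup>p\<close> is out of range, but it can be renormalised to \<open>\<plusminus>1\<close> by
  increasing the exponent. It occurs when rounding crosses into the next binade.\<close>

lemma scaled_int_in_floats:
  assumes "p > 0" and "\<bar>k\<bar> \<le> 2 ^ p"
  shows "of_int k * 2 powi f \<in> floats p"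
proof (cases "\<bar>k\<bar> = 2 ^ p")
  case False
  then have "\<bar>k\<bar> < 2 ^ p"
    using assms(2) by simp
  then show ?thesis
    unfolding floats_def by blast
next
  case True
  have "(of_int k :: real) = of_int (sgn k) * 2 ^ p"
    using mult_sgn_abs[of k] True
    by (metis of_int_mult of_int_numeral of_int_power)
  then have "of_int k * 2 powi f = (of_int (sgn k) * 2 powi (f + int p) :: real)"
    by (simp add: power_int_add)
  moreover have "\<bar>sgn k\<bar> < 2 ^ p"
    using one_less_power[of "2::int" p] assms(1) by (auto simp: abs_sgn_eq)
  ultimately show ?thesis
    unfolding floats_def by blast
qed

lemma zero_in_floats: "0 \<in> floats p"
  unfolding floats_def by force

text \<open>A significand below \<open>2\<^sup>p\<close> forces a number of magnitude at least \<open>2\<^sup>e\<close> to have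
  an exponent above \<open>e - p\<close>, which makes it a multiple of the step \<open>2\<^sup>e\<^sup>+\<^sup>1\<^sup>-\<^sup>p\<close>.\<close>

lemma large_float_is_scaled_int:
  assumes "b \<in> floats p" and "2 powi e \<le> \<bar>b\<bar>"
  shows "\<exists>j. b = of_int j * 2 powi (e + 1 - int p)"
proof -
  obtain m f where b: "b = of_int m * 2 powi f" and m: "\<bar>m\<bar> < 2 ^ p"
    using assms(1) unfolding floats_def by blast
  have "(of_int \<bar>m\<bar> :: real) < 2 ^ p"
    using m by (metis of_int_less_iff of_int_numeral of_int_power)
  then have "\<bar>b\<bar> < 2 ^ p * 2 powi f"
    by (simp add: b abs_mult)
  then have "(2::real) powi e < 2 powi (int p + f)"
    using assms(2) by (simp add: power_int_add)
  then have "e < int p + f"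
    using power_int_increasing[of "int p + f" e "2::real"] by force
  then have "e + 1 - int p \<le> f"
    by simp
  then obtain d where d: "f = (e + 1 - int p) + int d"
    by (rule zle_iff_zadd[THEN iffD1, THEN exE])
  have "b = of_int (m * 2 ^ d) * 2 powi (e + 1 - int p)"
    unfolding b d by (simp add: power_int_add[of _ _ "int d"])
  then show ?thesis
    by blast
qed

lemma ex_binade:
  assumes "x \<noteq> (0::real)"
  shows "\<exists>e. 2 powi e \<le> \<bar>x\<bar> \<and> \<bar>x\<bar> < 2 powi (e + 1)"
proof (intro exI conjI)
  let ?e = "\<lfloor>log 2 \<bar>x\<bar>\<rfloor>"
  have x: "\<bar>x\<bar> > 0"
    using assms by simp
  have "2 powr of_int ?e \<le> \<bar>x\<bar>"
    using x by (simp add: powr_le_iff)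
  then show "2 powi ?e \<le> \<bar>x\<bar>"
    by (simp add: powr_real_of_int')
  have "\<bar>x\<bar> < 2 powr of_int (?e + 1)"
    using x by (subst less_powr_iff) auto
  then show "\<bar>x\<bar> < 2 powi (?e + 1)"
    using powr_real_of_int'[of 2 "?e + 1"] by simp
qed

text \<open>The two neighbours may coincide, namely when \<open>x\<close> is itself a floating-point number;
  this also covers \<open>x = 0\<close>. When they differ, the gap between them is one step of the
  binade of \<open>x\<close>.\<close>

lemma floats_bracket:
  assumes "p > 0"
  shows "\<exists>lo\<in>floats p. \<exists>hi\<in>floats p. lo \<le> x \<and> x \<le> hi \<and>
           hi - lo \<le> 2 powi (1 - int p) * \<bar>x\<bar> \<and> (\<forall>b\<in>floats p. (x \<le> b \<longrightarrow> hi \<le> b) \<and> (b \<le> x \<longrightarrow> b \<le> lo))"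
proof (cases "x = 0")
  case True
  then show ?thesis
    using zero_in_floats by (intro bexI[of _ 0]) auto
next
  case False
  obtain e where e: "2 powi e \<le> \<bar>x\<bar>" "\<bar>x\<bar> < 2 powi (e + 1)"
    using ex_binade[OF False] by blast
  define h :: real where "h = 2 powi (e + 1 - int p)"
  define N :: int where "N = 2 ^ (p - 1)"
  define k where "k = \<lfloor>x / h\<rfloor>"
  define c where "c = \<lceil>x / h\<rceil>"
  have h: "h > 0"
    by (simp add: h_def)
  have two_N: "2 ^ p = 2 * N"
    using assms by (simp add: N_def flip: power_Suc)
  have N_real: "(of_int N :: real) = 2 powi (int p - 1)"
    using assms by (simp add: N_def power_int_def nat_diff_distrib)
  have N_h: "of_int N * h = 2 powi e"
    unfolding N_real h_def by (simp flip: power_int_add)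
  have N2_h: "2 * of_int N * h = 2 powi (e + 1)"
    using N_h by (simp add: power_int_add)
  have binade: "of_int N \<le> \<bar>x / h\<bar>" "\<bar>x / h\<bar> < 2 * of_int N"
    using e h unfolding N_h[symmetric] N2_h[symmetric]
    by (simp_all add: pos_le_divide_eq pos_divide_less_eq)
  \<comment> \<open>The binade boundaries are multiples of \<open>h\<close>, so rounding \<open>x / h\<close> to an integer keeps it
    between them.\<close>
  have range: "N \<le> k \<and> c \<le> 2 * N \<or> - (2 * N) \<le> k \<and> c \<le> - N"
  proof (cases "x > 0")
    case True
    then have "x / h > 0"
      using h by simp
    then have "of_int N \<le> x / h" "x / h \<le> of_int (2 * N)"
      using binade by (simp_all only: abs_of_pos of_int_mult of_int_numeral less_imp_le)
    then show ?thesis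
      unfolding k_def c_def by (simp only: le_floor_iff ceiling_le_iff simp_thms)
  next
    case False
    then have "x / h \<le> 0"
      using h by (simp add: divide_nonpos_pos)
    then have "\<bar>x / h\<bar> = - (x / h)"
      by (rule abs_of_nonpos)
    then have "of_int (- (2 * N)) \<le> x / h" "x / h \<le> of_int (- N)"
      using binade by simp_all
    then show ?thesis
      unfolding k_def c_def by (simp only: le_floor_iff ceiling_le_iff simp_thms)
  qed
  have kc: "of_int k \<le> x / h" "x / h \<le> of_int c" "k \<le> c" "c \<le> k + 1"
    unfolding k_def c_def by linarith+
  have "N > 0"
    by (simp add: N_def)
  then have "\<bar>k\<bar> \<le> 2 ^ p" "\<bar>c\<bar> \<le> 2 ^ p"
    using range kc(3) by (auto simp: two_N)
  then have in_floats: "of_int k * h \<in> floats p" "of_int c * h \<in> floats p"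
    unfolding h_def using scaled_int_in_floats[OF assms] by blast+
  have "of_int c \<le> (of_int k + 1 :: real)"
    using kc(4) by linarith
  then have "of_int c * h \<le> (of_int k + 1) * h"
    using h by (intro mult_right_mono) auto
  then have "of_int c * h - of_int k * h \<le> h"
    by (simp add: algebra_simps)
  also have "h = 2 powi (1 - int p) * 2 powi e"
    unfolding h_def by (simp add: algebra_simps flip: power_int_add)
  also have "\<dots> \<le> 2 powi (1 - int p) * \<bar>x\<bar>"
    using e(1) by (intro mult_left_mono) auto
  finally have gap: "of_int c * h - of_int k * h \<le> 2 powi (1 - int p) * \<bar>x\<bar>" .
  have on_grid: "\<exists>j. b = of_int j * h"
    if b: "b \<in> floats p" and between: "of_int k * h \<le> b" "b \<le> of_int c * h" for b
  proof -
    have "2 powi e \<le> \<bar>b\<bar>"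
      using range
    proof
      assume "N \<le> k \<and> c \<le> 2 * N"
      then have "of_int N * h \<le> of_int k * h"
        using h by (intro mult_right_mono) auto
      then show ?thesis
        using between N_h by linarith
    next
      assume "- (2 * N) \<le> k \<and> c \<le> - N"
      then have "of_int c * h \<le> of_int (- N) * h"
        using h by (intro mult_right_mono) (auto simp only: of_int_le_iff)
      then show ?thesis
        using between N_h by simp
    qed
    then show ?thesis
      using large_float_is_scaled_int[OF b] unfolding h_def by blast
  qed
  have bracket: "of_int k * h \<le> x" "x \<le> of_int c * h"
    using kc(1,2) h by (simp_all add: pos_le_divide_eq pos_divide_le_eq)
  have least: "of_int c * h \<le> b" if b: "b \<in> floats p" "x \<le> b" for b
  proof (cases "b \<le> of_int c * h")
    case True
    then obtain j where j: "b = of_int j * h"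
      using on_grid b bracket by force
    then have "c \<le> j"
      using b(2) h unfolding c_def by (simp add: ceiling_le_iff pos_divide_le_eq)
    then show ?thesis
      using h j by simp
  qed simp
  have greatest: "b \<le> of_int k * h" if b: "b \<in> floats p" "b \<le> x" for b
  proof (cases "of_int k * h \<le> b")
    case True
    then obtain j where j: "b = of_int j * h"
      using on_grid b bracket by force
    then have "j \<le> k"
      using b(2) h unfolding k_def by (simp add: le_floor_iff pos_le_divide_eq)
    then show ?thesis
      using h j by simp
  qed simp
  show ?thesis
    using in_floats gap bracket least greatest by blast
qed

lemma rounding_relative_error:
  assumes "p > 0" and "rounding p \<rho> u"
  shows "\<bar>\<rho> x - x\<bar> \<le> u * \<bar>x\<bar>"
proof -
  obtain lo hi where lo: "lo \<in> floats p" "lo \<le> x" and hi: "hi \<in> floats p" "x \<le> hi"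
    and gap: "hi - lo \<le> 2 powi (1 - int p) * \<bar>x\<bar>"
    and least: "\<And>b. b \<in> floats p \<Longrightarrow> x \<le> b \<Longrightarrow> hi \<le> b"
    and greatest: "\<And>b. b \<in> floats p \<Longrightarrow> b \<le> x \<Longrightarrow> b \<le> lo"
    using floats_bracket[OF assms(1), of x] by blast
  have RU: "round_RU p x = hi"
    unfolding round_RU_def using hi least by (intro Least_equality) auto
  have RD: "round_RD p x = lo"
    unfolding round_RD_def using lo greatest by (intro Greatest_equality) auto
  from assms(2) consider
      (directed) "\<rho> \<in> {round_RU p, round_RD p, round_RZ p}" "u = 2 powi (1 - int p)"
    | (nearest) "is_round_RN p \<rho>" "u = 2 powi (- int p)"
    unfolding rounding_def by blast
  then show ?thesis
  proof cases
    case directed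
    then have "\<rho> x = lo \<or> \<rho> x = hi"
      using RU RD by (auto simp: round_RZ_def)
    then show ?thesis
      using lo hi gap directed(2) by auto
  next
    case nearest
    have "\<bar>\<rho> x - x\<bar> \<le> \<bar>x - lo\<bar>" "\<bar>\<rho> x - x\<bar> \<le> \<bar>x - hi\<bar>"
      using nearest(1) lo hi unfolding is_round_RN_def by (metis abs_minus_commute)+
    then have "2 * \<bar>\<rho> x - x\<bar> \<le> hi - lo"
      using lo(2) hi(2) by simp
    moreover have "2 powi (1 - int p) = 2 * u"
      using nearest(2) by (simp add: power_int_diff power_int_minus divide_simps)
    ultimately show ?thesis
      using gap by simp
  qed
qed

lemma abs_ln_one_plus_le:
  fixes t u :: real
  assumes "\<bar>t\<bar> \<le> u" and "u < 1"
  shows "\<bar>ln (1 + t)\<bar> \<le> u / (1 - u)"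
proof -
  have pos: "0 < 1 - u" "1 - u \<le> 1 + t" "0 \<le> u"
    using assms by auto
  have "u \<le> u / (1 - u)"
    using pos by (simp add: field_simps)
  moreover have "ln (1 + t) \<le> t"
    using pos by (intro ln_add_one_self_le_self2) auto
  ultimately have upper: "ln (1 + t) \<le> u / (1 - u)"
    using assms(1) by linarith
  \<comment> \<open>The lower bound is the tangent estimate of \<open>ln\<close> at the reciprocal \<open>1 / (1 + t)\<close>.\<close>
  have "- ln (1 + t) = ln (1 / (1 + t))"
    using pos by (simp add: ln_div)
  also have "\<dots> \<le> 1 / (1 + t) - 1"
    using pos by (intro ln_le_minus_one) auto
  also have "\<dots> \<le> 1 / (1 - u) - 1"
    using pos by (simp add: frac_le)
  also have "\<dots> = u / (1 - u)"
    using pos by (simp add: field_simps)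
  finally show ?thesis
    using upper by simp
qed

theorem theorem3p1:
  fixes p :: nat and \<rho> :: "real \<Rightarrow> real" and u x :: real
  assumes "p > 0"
    and "rounding p \<rho> u"
    and "0 < u" and "u < 1"
  shows "\<exists>\<delta>::real. \<rho> x = x * exp \<delta> \<and> \<bar>\<delta>\<bar> \<le> u / (1 - u)"
proof (cases "x = 0")
  case True
  then show ?thesis
    using rounding_relative_error[OF assms(1,2), of x] assms(3,4)
    by (intro exI[of _ 0]) simp
next
  case False
  define t where "t = (\<rho> x - x) / x"
  have t: "\<bar>t\<bar> \<le> u"
    using rounding_relative_error[OF assms(1,2), of x] False
    by (simp add: t_def divide_le_eq)
  have "\<rho> x = x * (1 + t)"
    using False by (simp add: t_def field_simps)
  also have "1 + t = exp (ln (1 + t))"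
    using t assms(4) by simp
  finally show ?thesis
    using abs_ln_one_plus_le[OF t assms(4)] by blast
qed

end
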